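(* Let $n\in\mathbb N$, let $q$ be a prime power, and let $c$ be a colouring of the points of $G\cong\mathrm{PG}(n-1,q)$ such that $|c(L)|\le 2$ for each two-dimensional subspace $L$ of $G$. Then there are subspaces $\varnothing=W_0\subseteq W_1\subseteq\dots\subseteq W_k=G$ of $G$ such that $|c(W_{i+1}-W_i)|\le 2$ for all $0\le i<k$.
   Context: $\mathrm{PG}(n-1,q)$ is the projective geometry whose points are the one-dimensional subspaces of $\mathbb F_q^n$; a subspace of it is the set of points contained in a linear subspace of $\mathbb F_q^n$, with dimension equal to that of the linear subspace (the zero subspace gives the empty subspace). A colouring is any function on the set of points; $c(X)$ denotes the set of colours used on $X$. *)

theory Defs
  imports "HOL-Library.Function_Algebras" "HOL-Number_Theory.Prime_Powers"
begin

text \<open>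
  The space \<open>F^n\<close> is the set of functions \<open>nat \<Rightarrow> 'a\<close> vanishing outside \<open>{..<n}\<close>, with pointwise
  operations. The dimension is thus an ordinary natural number and may be \<open>0\<close>.
\<close>

definition fun_scale :: "'a::field \<Rightarrow> (nat \<Rightarrow> 'a) \<Rightarrow> nat \<Rightarrow> 'a"
  where "fun_scale a v = (\<lambda>i. a * v i)"

global_interpretation fun_vs: vector_space fun_scale
  by unfold_locales (auto simp: fun_scale_def plus_fun_def algebra_simps)

definition coord_space :: "nat \<Rightarrow> (nat \<Rightarrow> 'a::field) set"
  where "coord_space n = {v. \<forall>i\<ge>n. v i = 0}"

record 'p geometry =
  points :: "'p set"
  dim_subspaces :: "nat \<Rightarrow> 'p set set"

definition geom_subspace :: "'p geometry \<Rightarrow> 'p set \<Rightarrow> bool"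
  where "geom_subspace G X \<longleftrightarrow> (\<exists>d. X \<in> dim_subspaces G d)"

definition pg_points :: "nat \<Rightarrow> (nat \<Rightarrow> 'a::field) set set"
  where "pg_points n = {p. fun_vs.subspace p \<and> p \<subseteq> coord_space n \<and> fun_vs.dim p = 1}"

text \<open>
  The argument is the dimension of the underlying linear space: over a field with \<open>q\<close> elements,
  \<open>proj_geometry n\<close> is \<open>PG(n-1,q)\<close>. Likewise the dimension of a subspace is its linear (not its
  projective) dimension, so points have dimension 1 and the empty subspace has dimension 0.
\<close>

definition proj_geometry :: "nat \<Rightarrow> (nat \<Rightarrow> 'a::field) set geometry"
  where "proj_geometry n =
    \<lparr> points = pg_points n,
      dim_subspaces = (\<lambda>d. {{p \<in> pg_points n. p \<subseteq> V} | V.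
        fun_vs.subspace V \<and> V \<subseteq> coord_space n \<and> fun_vs.dim V = d}) \<rparr>"

definition geom_iso :: "'p geometry \<Rightarrow> 'r geometry \<Rightarrow> bool"
  where "geom_iso G H \<longleftrightarrow>
    (\<exists>f. bij_betw f (points G) (points H) \<and>
      (\<forall>d X. X \<in> dim_subspaces G d \<longleftrightarrow> X \<subseteq> points G \<and> f ` X \<in> dim_subspaces H d))"

end

theory Submission imports Defs begin

text \<open>
  It suffices to find, in every nonzero space \<open>V\<close>, a proper subspace whose complement has at most two
  colours. Call a subspace \<open>K\<close> of \<open>V\<close> a colour module if the colour of a vector outside \<open>K\<close> depends only on
  its class modulo \<open>K\<close>. The span of a colour class is a colour module, since a line through a point of
  colour \<open>a\<close> and a point outside the span has exactly one point of colour \<open>a\<close>. A nontrivial colour module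
  allows induction on a complement of it, so in a minimal counterexample all colour classes span \<open>V\<close>.

  If three points of distinct colours span \<open>V\<close>, double counting of points in the plane gives a
  contradiction. Otherwise they lie in a hyperplane \<open>H\<close>. By induction, some colour class of \<open>H\<close> lies in a
  proper subspace of \<open>H\<close>, hence in a maximal proper colour module \<open>K\<close> of \<open>H\<close>. Either \<open>H - K\<close> has a single
  colour, and then a colour class of \<open>V\<close> does not span \<open>V\<close>; or \<open>K\<close> is a colour module of \<open>V\<close> as well.
\<close>

section \<open>Double counting in a projective plane with three colour classes\<close>

locale coloured_plane =
  fixes X Y Z :: "'p set" and lines :: "'p set set"
  assumes finite_points: "finite (X \<union> Y \<union> Z)"
    and disjoint: "X \<inter> Y = {}" "X \<inter> Z = {}" "Y \<inter> Z = {}"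
    and nonempty: "X \<noteq> {}" "Y \<noteq> {}" "Z \<noteq> {}"
    and line_points: "L \<in> lines \<Longrightarrow> L \<subseteq> X \<union> Y \<union> Z"
    and line_exists: "\<lbrakk>x \<in> X \<union> Y \<union> Z; y \<in> X \<union> Y \<union> Z; x \<noteq> y\<rbrakk> \<Longrightarrow> \<exists>L\<in>lines. x \<in> L \<and> y \<in> L"
    and line_unique: "\<lbrakk>L \<in> lines; M \<in> lines; x \<in> L; y \<in> L; x \<in> M; y \<in> M; x \<noteq> y\<rbrakk> \<Longrightarrow> L = M"
    and lines_meet: "\<lbrakk>L \<in> lines; M \<in> lines\<rbrakk> \<Longrightarrow> L \<inter> M \<noteq> {}"
    and not_rainbow: "L \<in> lines \<Longrightarrow> L \<inter> X = {} \<or> L \<inter> Y = {} \<or> L \<inter> Z = {}"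
    and not_collinear: "L \<in> lines \<Longrightarrow> \<not> X \<subseteq> L" "L \<in> lines \<Longrightarrow> \<not> Y \<subseteq> L" "L \<in> lines \<Longrightarrow> \<not> Z \<subseteq> L"
begin

text \<open>The axioms are symmetric in the three classes. Together with \<open>swap_YZ\<close> this
  generates all permutations, so each count below is made for one arrangement only.\<close>

lemma swap_XY: "coloured_plane Y X Z lines"
proof -
  have eq: "Y \<union> X \<union> Z = X \<union> Y \<union> Z" by blast
  show ?thesis
  proof (rule coloured_plane.intro, unfold eq)
    show "Y \<inter> X = {}" "Y \<inter> Z = {}" "X \<inter> Z = {}"
      using disjoint by (simp_all add: Int_commute)
    show "L \<inter> Y = {} \<or> L \<inter> X = {} \<or> L \<inter> Z = {}" if "L \<in> lines" for L
      using not_rainbow[OF that] by argo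
  qed (fact finite_points nonempty line_points line_exists line_unique lines_meet not_collinear)+
qed

lemma swap_YZ: "coloured_plane X Z Y lines"
proof -
  have eq: "X \<union> Z \<union> Y = X \<union> Y \<union> Z" by blast
  show ?thesis
  proof (rule coloured_plane.intro, unfold eq)
    show "X \<inter> Z = {}" "X \<inter> Y = {}" "Z \<inter> Y = {}"
      using disjoint by (simp_all add: Int_commute)
    show "L \<inter> X = {} \<or> L \<inter> Z = {} \<or> L \<inter> Y = {}" if "L \<in> lines" for L
      using not_rainbow[OF that] by argo
  qed (fact finite_points nonempty line_points line_exists line_unique lines_meet not_collinear)+
qed

lemma finite_lines: "finite lines"
  by (rule finite_subset[of _ "Pow (X \<union> Y \<union> Z)"]) (use line_points finite_points in auto)

lemma finite_line: "L \<in> lines \<Longrightarrow> finite L"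
  using line_points finite_points by (meson finite_subset)

text \<open>By \<open>line_unique\<close> the choice is canonical for distinct points; for
  \<open>x = y\<close> it is arbitrary.\<close>

definition join :: "'p \<Rightarrow> 'p \<Rightarrow> 'p set"
  where "join x y = (SOME L. L \<in> lines \<and> x \<in> L \<and> y \<in> L)"

lemma join:
  assumes "x \<in> X \<union> Y \<union> Z" "y \<in> X \<union> Y \<union> Z" "x \<noteq> y"
  shows "join x y \<in> lines" "x \<in> join x y" "y \<in> join x y"
proof -
  have "\<exists>L. L \<in> lines \<and> x \<in> L \<and> y \<in> L" using line_exists[OF assms] by blast
  from someI_ex[OF this] show "join x y \<in> lines" "x \<in> join x y" "y \<in> join x y"
    unfolding join_def by auto
qed

text \<open>A line through \<open>z\<close> that meets \<open>X\<close> misses \<open>Y\<close>,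
  while \<open>L\<close> misses \<open>Z\<close>, so the two lines meet in a point of
  \<open>X\<close>. Joining \<open>z\<close> to the points of \<open>L\<close> in \<open>X\<close>
  thus reaches every such line, and each only once because \<open>z\<close> is off
  \<open>L\<close>.\<close>

lemma card_pencil:
  assumes z: "z \<in> Z" and L: "L \<in> lines" "L \<inter> Z = {}"
  shows "card {M \<in> lines. z \<in> M \<and> M \<inter> X \<noteq> {}} = card (L \<inter> X)"
proof -
  have "bij_betw (join z) (L \<inter> X) {M \<in> lines. z \<in> M \<and> M \<inter> X \<noteq> {}}"
    unfolding bij_betw_def
  proof
    have zj: "join z p \<in> lines \<and> z \<in> join z p \<and> p \<in> join z p" if "p \<in> X" for p
      using that z join[of z p] disjoint by blast
    show "inj_on (join z) (L \<inter> X)"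
    proof (rule inj_onI)
      fix p p' assume *: "p \<in> L \<inter> X" "p' \<in> L \<inter> X" "join z p = join z p'"
      show "p = p'"
      proof (rule ccontr)
        assume "p \<noteq> p'"
        then have "join z p = L" using line_unique[of "join z p" L p p'] * zj[of p] zj[of p'] L by auto
        then show False using zj[of p] * z L by auto
      qed
    qed
    show "join z ` (L \<inter> X) = {M \<in> lines. z \<in> M \<and> M \<inter> X \<noteq> {}}"
    proof (intro subset_antisym subsetI)
      fix M assume "M \<in> {M \<in> lines. z \<in> M \<and> M \<inter> X \<noteq> {}}"
      then have M: "M \<in> lines" "z \<in> M" "M \<inter> X \<noteq> {}" by auto
      obtain p where p: "p \<in> L" "p \<in> M" using lines_meet[OF L(1) M(1)] by blast
      have "M \<inter> Y = {}" using not_rainbow[OF M(1)] M z by blast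
      then have pX: "p \<in> X" using p L line_points[OF M(1)] by blast
      then have "join z p = M"
        using line_unique[of "join z p" M z p] zj[OF pX] M p z disjoint by blast
      then show "M \<in> join z ` (L \<inter> X)" using p pX by blast
    qed (use zj in auto)
  qed
  from bij_betw_same_card[OF this] show ?thesis by simp
qed

lemma card_by_pencil:
  assumes x: "x \<in> X \<union> Y \<union> Z" and S: "S \<subseteq> X \<union> Y \<union> Z"
  shows "card (S - {x}) = (\<Sum>M | M \<in> lines \<and> x \<in> M. card (M \<inter> S - {x}))"
proof -
  have "S - {x} = (\<Union>M\<in>{M. M \<in> lines \<and> x \<in> M}. M \<inter> S - {x})"
    using line_exists[OF x] S by blast
  moreover have "card (\<Union>M\<in>{M. M \<in> lines \<and> x \<in> M}. M \<inter> S - {x})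
      = (\<Sum>M | M \<in> lines \<and> x \<in> M. card (M \<inter> S - {x}))"
  proof (rule card_UN_disjoint)
    show "finite {M. M \<in> lines \<and> x \<in> M}" using finite_lines by simp
    show "\<forall>M\<in>{M. M \<in> lines \<and> x \<in> M}. finite (M \<inter> S - {x})" using finite_line by auto
    show "\<forall>M\<in>{M. M \<in> lines \<and> x \<in> M}. \<forall>N\<in>{M. M \<in> lines \<and> x \<in> M}. M \<noteq> N \<longrightarrow>
        (M \<inter> S - {x}) \<inter> (N \<inter> S - {x}) = {}"
      using line_unique by blast
  qed
  ultimately show ?thesis by simp
qed

text \<open>A single line through \<open>z\<close> meeting \<open>X\<close> would contain all of
  \<open>X\<close>, against \<open>not_collinear\<close>.\<close>

lemma pencil_ge_2:
  assumes z: "z \<in> Z"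
  shows "card {M \<in> lines. z \<in> M \<and> M \<inter> X \<noteq> {}} \<ge> 2"
proof -
  let ?S = "{M \<in> lines. z \<in> M \<and> M \<inter> X \<noteq> {}}"
  obtain x where x: "x \<in> X" using nonempty by blast
  have 1: "join z x \<in> ?S" using join[of z x] x z disjoint by blast
  then obtain x' where x': "x' \<in> X" "x' \<notin> join z x" using not_collinear(1)[of "join z x"] by blast
  have 2: "join z x' \<in> ?S" "x' \<in> join z x'" using join[of z x'] x' z disjoint by blast+
  have "card {join z x, join z x'} \<le> card ?S"
    by (rule card_mono) (use 1 2 finite_lines in auto)
  moreover have "join z x \<noteq> join z x'" using x' 2 by auto
  ultimately show ?thesis by simp
qed

lemma card_line_ge_2: "L \<in> lines \<Longrightarrow> L \<inter> Z = {} \<Longrightarrow> card (L \<inter> X) \<ge> 2"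
  using card_pencil[of _ L] pencil_ge_2 nonempty(3) by fastforce

text \<open>By \<open>card_pencil\<close> both numbers count the same pencil at a point of
  \<open>Z\<close>, which does not depend on the line.\<close>

lemma card_line_const: 
  "\<lbrakk>L \<in> lines; L \<inter> Z = {}; M \<in> lines; M \<inter> Z = {}\<rbrakk> \<Longrightarrow> card (L \<inter> X) = card (M \<inter> X)"
  using card_pencil[of _ L] card_pencil[of _ M] nonempty(3) by fastforce

text \<open>
  With \<open>p\<close> and \<open>s\<close> points of \<open>X\<close> on the lines missing \<open>Z\<close> and \<open>Y\<close>, the pencil of a point of \<open>Z\<close> gives
  \<open>card X = p * s\<close>, and the pencil of a point of \<open>X\<close> gives \<open>card X - 1 = r * (p - 1) + r' * (s - 1)\<close>,
  where \<open>r\<close> and \<open>r'\<close> count the lines of this pencil that meet \<open>Y\<close> and \<open>Z\<close>. The conclusion is the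
  inequality \<open>r < s\<close>; exchanging \<open>X\<close> and \<open>Y\<close> reverses it.
\<close>

lemma card_less:
  assumes L: "L \<in> lines" "L \<inter> Y = {}" and M: "M \<in> lines" "M \<inter> X = {}"
  shows "card (M \<inter> Y) < card (L \<inter> X)"
proof -
  interpret YXZ: coloured_plane Y X Z lines by (rule swap_XY)
  interpret XZY: coloured_plane X Z Y lines by (rule swap_YZ)
  interpret YZX: coloured_plane Y Z X lines by (rule YXZ.swap_YZ)
  interpret ZYX: coloured_plane Z Y X lines by (rule YZX.swap_XY)
  obtain x y z where xyz: "x \<in> X" "y \<in> Y" "z \<in> Z" using nonempty by blast
  define N where "N = join x y"
  have N: "N \<in> lines" "N \<inter> Z = {}"
    using join[of x y] xyz disjoint not_rainbow[of "join x y"] unfolding N_def by blast+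
  define p s r r' where "p = card (N \<inter> X)" and "s = card (L \<inter> X)" and "r = card (M \<inter> Y)"
    and "r' = card (M \<inter> Z)"
  have ge: "p \<ge> 2" "s \<ge> 2" "r \<ge> 2" "r' \<ge> 2"
    unfolding p_def s_def r_def r'_def
    using card_line_ge_2[OF N] XZY.card_line_ge_2[OF L] YZX.card_line_ge_2[OF M]
      ZYX.card_line_ge_2[OF M] by auto
  have p: "card (K \<inter> X) = p" if "K \<in> lines" "K \<inter> Z = {}" for K
    unfolding p_def using card_line_const[OF that N] .
  have s: "card (K \<inter> X) = s" if "K \<in> lines" "K \<inter> Y = {}" for K
    unfolding s_def using XZY.card_line_const[OF that L] .
  let ?Sy = "{K \<in> lines. x \<in> K \<and> K \<inter> Y \<noteq> {}}" and ?Sz = "{K \<in> lines. x \<in> K \<and> K \<inter> Z \<noteq> {}}"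
  have cSy: "card ?Sy = r" unfolding r_def using YZX.card_pencil[OF xyz(1) M] .
  have cSz: "card ?Sz = r'" unfolding r'_def using ZYX.card_pencil[OF xyz(1) M] .
  have zX: "z \<notin> X" using xyz disjoint by blast
  then have "card X = card (X - {z})" by simp
  also have "\<dots> = (\<Sum>K | K \<in> lines \<and> z \<in> K. card (K \<inter> X - {z}))"
    by (rule card_by_pencil) (use xyz in auto)
  \<comment> \<open>Lines through \<open>z\<close> that miss \<open>X\<close> contribute 0. The
    others miss \<open>Y\<close>, so they contain exactly \<open>s\<close> points of
    \<open>X\<close>.\<close>
  also have "\<dots> = (\<Sum>K | K \<in> lines \<and> z \<in> K \<and> K \<inter> X \<noteq> {}. s)"
  proof (rule sum.mono_neutral_cong_right)
    fix K assume "K \<in> {K. K \<in> lines \<and> z \<in> K \<and> K \<inter> X \<noteq> {}}"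
    then have K: "K \<in> lines" "z \<in> K" "K \<inter> X \<noteq> {}" by auto
    then have "K \<inter> Y = {}" using not_rainbow[of K] xyz by blast
    then show "card (K \<inter> X - {z}) = s" using s[of K] K zX by simp
  qed (use finite_lines in \<open>auto simp: card_eq_0_iff\<close>)
  also have "\<dots> = p * s" using card_pencil[OF xyz(3) N] by (simp add: p_def)
  finally have cX: "card X = p * s" .
  have finX: "finite X" using finite_points by simp
  have "card X - 1 = card (X - {x})" using xyz finX by simp
  also have "\<dots> = (\<Sum>K | K \<in> lines \<and> x \<in> K. card (K \<inter> X - {x}))"
    by (rule card_by_pencil) (use xyz in auto)
  \<comment> \<open>Every line through \<open>x\<close> meets \<open>Y\<close> or \<open>Z\<close>,
    since a line missing \<open>Z\<close> has at least two points of \<open>Y\<close>. None meets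
    both, which lets the sum split below.\<close>
  also have "{K. K \<in> lines \<and> x \<in> K} = ?Sy \<union> ?Sz"
  proof -
    have "K \<inter> Y \<noteq> {}" if "K \<in> lines" "K \<inter> Z = {}" for K
      using YXZ.card_line_ge_2[OF that] by auto
    then show ?thesis by blast
  qed
  also have "(\<Sum>K\<in>?Sy \<union> ?Sz. card (K \<inter> X - {x}))
    = (\<Sum>K\<in>?Sy. card (K \<inter> X - {x})) + (\<Sum>K\<in>?Sz. card (K \<inter> X - {x}))"
    by (rule sum.union_disjoint) (use finite_lines not_rainbow xyz in auto)
  also have "(\<Sum>K\<in>?Sy. card (K \<inter> X - {x})) = (\<Sum>K\<in>?Sy. p - 1)"
  proof (rule sum.cong[OF refl])
    fix K assume "K \<in> ?Sy"
    then have K: "K \<in> lines" "x \<in> K" "K \<inter> Y \<noteq> {}" by auto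
    then have "K \<inter> Z = {}" using not_rainbow[of K] xyz by blast
    then show "card (K \<inter> X - {x}) = p - 1" using p[of K] K xyz finX by simp
  qed
  also have "(\<Sum>K\<in>?Sz. card (K \<inter> X - {x})) = (\<Sum>K\<in>?Sz. s - 1)"
  proof (rule sum.cong[OF refl])
    fix K assume "K \<in> ?Sz"
    then have K: "K \<in> lines" "x \<in> K" "K \<inter> Z \<noteq> {}" by auto
    then have "K \<inter> Y = {}" using not_rainbow[of K] xyz by blast
    then show "card (K \<inter> X - {x}) = s - 1" using s[of K] K xyz finX by simp
  qed
  finally have eq: "p * s - 1 = r * (p - 1) + r' * (s - 1)" by (simp add: cX cSy cSz)
  obtain p1 s1 r1 where d: "p = p1 + 2" "s = s1 + 2" "r' = r1 + 2"
    using ge by (metis le_add_diff_inverse2)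
  \<comment> \<open>If \<open>s\<close> were at most \<open>r\<close>, then, as \<open>r'\<close> is
    at least 2, the right side of \<open>eq\<close> would be at least
    \<open>s * (p - 1) + 2 * (s - 1) = p * s + s - 2\<close>. This exceeds \<open>p * s - 1\<close>
    because \<open>s\<close> is at least 2.\<close>
  have "r < s"
  proof (rule ccontr)
    assume "\<not> r < s"
    then have "r * (p - 1) \<ge> s * (p - 1)" by simp
    moreover have "r' * (s - 1) \<ge> 2 * (s - 1)" using ge by simp
    ultimately have "p * s - 1 \<ge> s * (p - 1) + 2 * (s - 1)" using eq by linarith
    then show False by (simp add: d algebra_simps)
  qed
  then show ?thesis by (simp add: r_def s_def)
qed

end

text \<open>\<open>card_less\<close> is applied to the same two lines with \<open>X\<close> and
  \<open>Y\<close> in both orders; the two strict inequalities contradict each other.\<close>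

lemma not_coloured_plane: "\<not> coloured_plane X Y Z lines"
proof
  assume "coloured_plane X Y Z lines"
  then interpret coloured_plane X Y Z lines .
  interpret YXZ: coloured_plane Y X Z lines by (rule swap_XY)
  obtain x y z where xyz: "x \<in> X" "y \<in> Y" "z \<in> Z" using nonempty by blast
  have L: "join x z \<in> lines" "join x z \<inter> Y = {}"
    using join[of x z] xyz disjoint not_rainbow[of "join x z"] by blast+
  have M: "join y z \<in> lines" "join y z \<inter> X = {}"
    using join[of y z] xyz disjoint not_rainbow[of "join y z"] by blast+
  show False using card_less[OF L M] YXZ.card_less[OF M L] by simp
qed

text \<open>Complements, hyperplanes and maximal colour modules are all obtained below as maximal
  members of a family of subsets of a finite space.\<close>

lemma ex_maximal_subset:
  assumes "finite V" "\<And>C. Q C \<Longrightarrow> C \<subseteq> V" "Q C0"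
  shows "\<exists>C. Q C \<and> C0 \<subseteq> C \<and> (\<forall>D. Q D \<longrightarrow> C \<subseteq> D \<longrightarrow> D = C)"
proof -
  have "finite (Collect Q)" by (rule finite_subset[of _ "Pow V"]) (use assms in auto)
  from finite_has_maximal2[OF this, of C0] assms(3) show ?thesis by auto
qed

section \<open>Colour modules of a coloured vector space\<close>

locale coloured_vector_space = vector_space scale
  for scale :: "'a::field \<Rightarrow> 'b::ab_group_add \<Rightarrow> 'b"  (infixr \<open>*s\<close> 75)
begin

text \<open>
  A colouring of the points of a projective geometry is treated as a scale invariant colouring
  of nonzero vectors; the colour of the zero vector is junk.
\<close>

definition rainbow_free :: "'b set \<Rightarrow> ('b \<Rightarrow> 'c) \<Rightarrow> bool" where
  "rainbow_free V g \<longleftrightarrow>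
    (\<forall>v\<in>V. \<forall>l. l \<noteq> 0 \<longrightarrow> g (l *s v) = g v) \<and>
    (\<forall>u\<in>V. \<forall>v\<in>V. u \<noteq> 0 \<longrightarrow> v \<noteq> 0 \<longrightarrow> u + v \<noteq> 0 \<longrightarrow> g u = g v \<or> g (u + v) = g u \<or> g (u + v) = g v)"

lemma rainbow_free_scale: "rainbow_free V g \<Longrightarrow> v \<in> V \<Longrightarrow> l \<noteq> 0 \<Longrightarrow> g (l *s v) = g v"
  unfolding rainbow_free_def by blast

lemma rainbow_free_add:
  "\<lbrakk>rainbow_free V g; u \<in> V; v \<in> V; u \<noteq> 0; v \<noteq> 0; u + v \<noteq> 0; g u \<noteq> g v\<rbrakk>
    \<Longrightarrow> g (u + v) = g u \<or> g (u + v) = g v"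
  unfolding rainbow_free_def by blast

lemma rainbow_free_subset: "rainbow_free V g \<Longrightarrow> U \<subseteq> V \<Longrightarrow> rainbow_free U g"
  unfolding rainbow_free_def by blast

text \<open>Nothing is asked of the colours inside \<open>K\<close>. Hence, for a subspace
  \<open>V\<close>, both \<open>{0}\<close> and \<open>V\<close> are colour modules; these are the
  trivial ones.\<close>

definition colour_module :: "'b set \<Rightarrow> 'b set \<Rightarrow> ('b \<Rightarrow> 'c) \<Rightarrow> bool" where
  "colour_module K V g \<longleftrightarrow> subspace K \<and> K \<subseteq> V \<and> (\<forall>v\<in>V - K. \<forall>k\<in>K. g (v + k) = g v)"

lemma colour_moduleD:
  assumes "colour_module K V g"
  shows "subspace K" "K \<subseteq> V" "\<lbrakk>v \<in> V; v \<notin> K; k \<in> K\<rbrakk> \<Longrightarrow> g (v + k) = g v"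
  using assms unfolding colour_module_def by auto

definition colour_class :: "'b set \<Rightarrow> ('b \<Rightarrow> 'c) \<Rightarrow> 'c \<Rightarrow> 'b set" where
  "colour_class V g a = {v \<in> V. v \<noteq> 0 \<and> g v = a}"

lemma subspace_scale_iff: "subspace S \<Longrightarrow> l \<noteq> 0 \<Longrightarrow> l *s x \<in> S \<longleftrightarrow> x \<in> S"
  using subspace_scale[of S "l *s x" "1 / l"] subspace_scale[of S x l] by auto

lemma subspace_add_iff: "subspace S \<Longrightarrow> y \<in> S \<Longrightarrow> x + y \<in> S \<longleftrightarrow> x \<in> S"
  using subspace_diff[of S "x + y" y] subspace_add[of S x y] by auto

text \<open>\<open>C\<close> is a maximal subspace meeting \<open>K\<close> only in 0. A vector
  \<open>v\<close> outside \<open>C + K\<close> could be adjoined to \<open>C\<close>: a vector of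
  \<open>K\<close> in the larger span with nonzero coefficient at \<open>v\<close> could be solved
  for \<open>v\<close>, placing it in \<open>C + K\<close>.\<close>

lemma subspace_complement:
  assumes V: "finite V" "subspace V" and K: "subspace K" "K \<subseteq> V"
  obtains C where "subspace C" "C \<subseteq> V" "C \<inter> K = {0}" "\<And>v. v \<in> V \<Longrightarrow> \<exists>c\<in>C. \<exists>k\<in>K. v = c + k"
proof -
  let ?Q = "\<lambda>C. subspace C \<and> C \<subseteq> V \<and> C \<inter> K = {0}"
  have "?Q {0}" using subspace_0[OF V(2)] subspace_0[OF K(1)] by auto
  then have "\<exists>C. ?Q C \<and> {0} \<subseteq> C \<and> (\<forall>D. ?Q D \<longrightarrow> C \<subseteq> D \<longrightarrow> D = C)"
    by (intro ex_maximal_subset[OF V(1)]) auto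
  then obtain C where C: "?Q C" and max: "\<forall>D. ?Q D \<longrightarrow> C \<subseteq> D \<longrightarrow> D = C" by blast
  have "\<exists>c\<in>C. \<exists>k\<in>K. v = c + k" if v: "v \<in> V" for v
  proof (rule ccontr)
    assume neg: "\<not> ?thesis"
    have spC: "span C = C" using C by simp
    have "?Q (span (insert v C))"
    proof (intro conjI)
      show "span (insert v C) \<subseteq> V" by (rule span_minimal) (use C v V in auto)
      show "span (insert v C) \<inter> K = {0}"
      proof (intro subset_antisym subsetI)
        fix x assume x: "x \<in> span (insert v C) \<inter> K"
        then obtain l where l: "x - l *s v \<in> C" using span_breakdown_eq[of x v C] spC by auto
        have "l = 0"
        proof (rule ccontr)
          assume l0: "l \<noteq> 0"
          define c where "c = x - l *s v"
          have "v = (- 1 / l) *s c + (1 / l) *s x"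
            using l0 by (simp add: c_def algebra_simps scale_right_diff_distrib)
          moreover have "c \<in> C" using l by (simp add: c_def)
          then have "(- 1 / l) *s c \<in> C" using C subspace_scale by blast
          moreover have "(1 / l) *s x \<in> K" using K x subspace_scale by blast
          ultimately show False using neg by blast
        qed
        then show "x \<in> {0}" using l x C by auto
      qed (use span_zero subspace_0[OF K(1)] in auto)
    qed simp
    moreover have "C \<subseteq> span (insert v C)" using span_superset by blast
    ultimately have "span (insert v C) = C" using max by blast
    then have "v \<in> C" using span_base[of v "insert v C"] by simp
    moreover have "v = v + 0" by simp
    ultimately show False using neg subspace_0[OF K(1)] by blast
  qed
  then show ?thesis using that C by blast
qed

text \<open>A complement \<open>C\<close> of \<open>K\<close> represents the classes modulo
  \<open>K\<close>. With \<open>U\<close> the subspace of \<open>C\<close> given by induction, the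
  sum \<open>U + K\<close> works: a vector outside it has the colour of its component in
  \<open>C\<close>, and that component is outside \<open>U\<close>.\<close>

lemma two_coloured_complement_of_colour_module:
  assumes V: "finite V" "subspace V" and K: "colour_module K V g" "K \<noteq> {0}" "K \<noteq> V"
    and IH: "\<And>C. \<lbrakk>subspace C; C \<subset> V; C \<noteq> {0}\<rbrakk> \<Longrightarrow> \<exists>U. subspace U \<and> U \<subset> C \<and> card (g ` (C - U)) \<le> 2"
  shows "\<exists>U. subspace U \<and> U \<subset> V \<and> card (g ` (V - U)) \<le> 2"
proof -
  note Kd = colour_moduleD[OF K(1)]
  obtain C where C: "subspace C" "C \<subseteq> V" "C \<inter> K = {0}"
    and sum: "\<And>v. v \<in> V \<Longrightarrow> \<exists>c\<in>C. \<exists>k\<in>K. v = c + k"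
    using subspace_complement[OF V Kd(1,2)] by blast
  have "C \<noteq> V" using C K(2) Kd(2) by auto
  moreover have "C \<noteq> {0}" using sum K(3) Kd(2) by fastforce
  ultimately obtain U where U: "subspace U" "U \<subset> C" "card (g ` (C - U)) \<le> 2"
    using IH[of C] C by auto
  define W where "W = {x + y |x y. x \<in> U \<and> y \<in> K}"
  have sW: "subspace W" unfolding W_def by (rule subspace_sums[OF U(1) Kd(1)])
  have WV: "W \<subseteq> V" using U C Kd V(2) unfolding W_def by (auto intro!: subspace_add)
  have CW: "c \<in> U" if "c \<in> C" "c \<in> W" for c
  proof -
    obtain x y where xy: "x \<in> U" "y \<in> K" "c = x + y" using \<open>c \<in> W\<close> unfolding W_def by blast
    have "y = c - x" using xy by simp
    then have "y \<in> C" using that xy U C subspace_diff by blast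
    then have "y = 0" using xy C by blast
    then show "c \<in> U" using xy by simp
  qed
  have "W \<noteq> V" using CW U C by blast
  moreover have "g ` (V - W) \<subseteq> g ` (C - U)"
  proof (rule image_subsetI)
    fix v assume v: "v \<in> V - W"
    then obtain c k where ck: "c \<in> C" "k \<in> K" "v = c + k" using sum by blast
    have cU: "c \<notin> U" using v ck unfolding W_def by blast
    then have "c \<noteq> 0" using subspace_0[OF U(1)] by auto
    then have "c \<notin> K" using ck(1) C(3) by auto
    then have "g v = g c" using Kd(3)[of c k] ck C by auto
    then show "g v \<in> g ` (C - U)" using ck cU by blast
  qed
  then have "card (g ` (V - W)) \<le> card (g ` (C - U))"
    by (rule card_mono[rotated]) (use V C finite_subset in blast)
  ultimately show ?thesis using sW WV U(3) by (intro exI[of _ W]) auto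
qed

text \<open>Elements of the span are reached by adding multiples of vectors of colour
  \<open>a\<close> one at a time. Each sum stays outside the span, hence off colour
  \<open>a\<close>, so \<open>rainbow_free_add\<close> leaves only the previous colour.\<close>

lemma colour_module_span_colour_class:
  assumes V: "subspace V" "rainbow_free V g"
  shows "colour_module (span (colour_class V g a)) V g"
proof -
  let ?A = "colour_class V g a"
  let ?K = "span ?A"
  have A: "x \<in> V" "x \<noteq> 0" "g x = a" if "x \<in> ?A" for x
    using that unfolding colour_class_def by auto
  have KV: "?K \<subseteq> V" by (rule span_minimal) (use A V in auto)
  have "\<forall>v\<in>V - ?K. g (v + k) = g v" if "k \<in> ?K" for k
    using that
  proof (induction rule: span_induct_alt)
    case (step c x y)
    show ?case
    proof
      fix v assume v: "v \<in> V - ?K"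
      have cx: "c *s x \<in> ?K" using step span_base span_scale by blast
      then have vcx: "v + c *s x \<in> V - ?K"
        using v KV subspace_add_iff[of ?K "c *s x" v] subspace_add[OF V(1)] by auto
      have notA: "w \<noteq> 0 \<and> g w \<noteq> a" if "w \<in> V - ?K" for w
      proof -
        have "w \<noteq> 0" using that span_zero by auto
        moreover have "w \<notin> ?A" using that span_base by auto
        ultimately show ?thesis using that unfolding colour_class_def by auto
      qed
      have "g (v + c *s x) = g v"
      proof (cases "c = 0")
        case False
        then have "c *s x \<noteq> 0" "g (c *s x) = a" "c *s x \<in> V"
          using A[OF step(1)] rainbow_free_scale[OF V(2)] subspace_scale[OF V(1)] by auto
        then show ?thesis
          using rainbow_free_add[OF V(2), of v "c *s x"] notA[OF v] notA[OF vcx] v by auto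
      qed simp
      moreover have "g ((v + c *s x) + y) = g (v + c *s x)" using step(2) vcx by blast
      ultimately show "g (v + (c *s x + y)) = g v" by (simp add: add.assoc)
    qed
  qed simp
  then show ?thesis unfolding colour_module_def using KV by auto
qed


section \<open>Colour modules of a hyperplane\<close>

lemma mem_span_insert_subspace: "subspace K \<Longrightarrow> x \<in> span (insert a K) \<longleftrightarrow> (\<exists>l. x - l *s a \<in> K)"
  using span_breakdown_eq[of x a K] span_eq_iff[of K] by metis

lemma colour_class_outside_hyperplane:
  assumes H: "subspace H" "H \<subset> V" and span: "span (colour_class V g a) = V"
  obtains s where "s \<in> V" "s \<notin> H" "s \<noteq> 0" "g s = a"
proof -
  have "\<not> colour_class V g a \<subseteq> H" using span_minimal[of "colour_class V g a" H] H span by auto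
  then show ?thesis using that unfolding colour_class_def by auto
qed

text \<open>Since \<open>s\<close> is outside \<open>H\<close>, the span of \<open>s\<close> and
  \<open>K\<close> meets \<open>H\<close> only in \<open>K\<close>.\<close>

lemma span_insert_proper:
  assumes H: "subspace H" "H \<subseteq> V" and K: "subspace K" "K \<subset> H" and s: "s \<notin> H"
  shows "span (insert s K) \<noteq> V"
proof
  assume V: "span (insert s K) = V"
  obtain h where h: "h \<in> H" "h \<notin> K" using K by blast
  have "h \<in> span (insert s K)" using V H h by auto
  then obtain l where l: "h - l *s s \<in> K" using mem_span_insert_subspace[OF K(1)] by blast
  then have "h - (h - l *s s) \<in> H" using K h subspace_diff[OF H(1)] by blast
  then have "l = 0" using subspace_scale_iff[OF H(1), of l s] s by auto
  then show False using l h by auto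
qed

text \<open>\<open>hyp\<close> expresses that \<open>H\<close> has codimension one. Fix
  \<open>s\<close> of colour \<open>a\<close> outside \<open>H\<close>. A vector \<open>t\<close> of
  colour \<open>c\<close> is a multiple of \<open>s\<close> plus a vector of \<open>H\<close>; were
  the latter outside \<open>K\<close>, it would have colour \<open>b\<close>, and \<open>t\<close>
  would have colour \<open>a\<close> or \<open>b\<close>. So colour \<open>c\<close> is confined to
  the span of \<open>s\<close> and \<open>K\<close>, which is proper.\<close>

lemma not_constant_off_colour_module:
  assumes V: "subspace V" "rainbow_free V g" and H: "subspace H" "H \<subset> V"
    and hyp: "\<And>x v. \<lbrakk>x \<in> V; v \<in> V; v \<notin> H\<rbrakk> \<Longrightarrow> \<exists>l. x - l *s v \<in> H"
    and K: "subspace K" "K \<subset> H" and const: "\<And>h. h \<in> H \<Longrightarrow> h \<notin> K \<Longrightarrow> g h = b"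
    and spanning: "span (colour_class V g a) = V" "span (colour_class V g c) = V"
    and distinct: "a \<noteq> b" "c \<noteq> b" "a \<noteq> c"
  shows False
proof -
  obtain s where s: "s \<in> V" "s \<notin> H" "s \<noteq> 0" "g s = a"
    using colour_class_outside_hyperplane[OF H spanning(1)] by blast
  have "colour_class V g c \<subseteq> span (insert s K)"
  proof
    fix t assume "t \<in> colour_class V g c"
    then have t: "t \<in> V" "t \<noteq> 0" "g t = c" unfolding colour_class_def by auto
    obtain l where l: "t - l *s s \<in> H" using hyp[OF t(1) s(1,2)] by blast
    have "t - l *s s \<in> K"
    proof (rule ccontr)
      assume nK: "t - l *s s \<notin> K"
      then have b: "g (t - l *s s) = b" using const l by blast
      then have l0: "l \<noteq> 0" using t distinct by auto
      have "t - l *s s \<noteq> 0" using nK subspace_0[OF K(1)] by metis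
      moreover have "l *s s \<noteq> 0" "l *s s \<in> V" "g (l *s s) = a"
        using l0 s subspace_scale[OF V(1)] rainbow_free_scale[OF V(2)] by auto
      ultimately have "g (t - l *s s + l *s s) \<in> {a, b}"
        using rainbow_free_add[OF V(2), of "t - l *s s" "l *s s"] b l H(2) t(2) distinct by auto
      then show False using t distinct by auto
    qed
    then show "t \<in> span (insert s K)" using mem_span_insert_subspace[OF K(1)] by blast
  qed
  then have "V \<subseteq> span (insert s K)" using span_minimal spanning(2) by (metis subspace_span)
  moreover have "span (insert s K) \<subseteq> V" by (rule span_minimal) (use s K H V in auto)
  ultimately show False using span_insert_proper[OF H(1) _ K s(2), of V] H(2) by blast
qed

text \<open>Used against a maximal \<open>K\<close>: if adding \<open>k\<close> to \<open>s\<close>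
  destroys colour \<open>a\<close> and adding \<open>h\<close> restores it, then \<open>K\<close>
  can be enlarged by \<open>h\<close>, and the enlargement brings in a single new colour.\<close>

lemma larger_colour_module:
  assumes V: "subspace V" "rainbow_free V g" and H: "subspace H" "H \<subset> V"
    and K: "colour_module K H g" and a: "colour_class H g a \<subseteq> K"
    and s: "s \<in> V" "s \<notin> H" "g s = a" and k: "k \<in> K" and t: "g (s + k) \<noteq> a"
    and h: "h \<in> H" "h \<notin> K" "g (s + k + h) = a"
  shows "colour_module (span (insert h K)) H g"
    and "\<And>x. x \<in> span (insert h K) \<Longrightarrow> x \<notin> K \<Longrightarrow> g x = g h"
proof -
  note Kd = colour_moduleD[OF K]
  let ?b = "g h" and ?t = "s + k" and ?L = "span (insert h K)"
  have kH: "k \<in> H" using k Kd(2) by blast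
  have offH: "s + y \<in> V" "s + y \<notin> H" "s + y \<noteq> 0" if "y \<in> H" for y
  proof -
    show "s + y \<in> V" using that s H V(1) subspace_add by blast
    show "s + y \<notin> H" using subspace_add_iff[OF H(1) that] s by blast
    then show "s + y \<noteq> 0" using subspace_0[OF H(1)] by auto
  qed
  have nz: "y \<noteq> 0" if "y \<notin> K" for y using that subspace_0[OF Kd(1)] by auto
  have nota: "g y \<noteq> a" if "y \<in> H" "y \<notin> K" for y
    using that a nz[OF that(2)] unfolding colour_class_def by auto
  have line: "g (s + y + z) = g (s + y) \<or> g (s + y + z) = g z"
    if "y \<in> H" "z \<in> H" "z \<notin> K" "g (s + y) \<noteq> g z" for y z
  proof -
    have "s + y + z \<noteq> 0" using offH(3)[of "y + z"] that subspace_add[OF H(1)] by (simp add: add.assoc)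
    then show ?thesis
      using rainbow_free_add[OF V(2), of "s + y" z] offH[OF that(1)] that nz[of z] H(2) by blast
  qed
  have lines: "g (s + (z + k)) = a \<or> g (s + (z + k)) = g z" if "z \<in> H" "z \<notin> K" for z
  proof -
    have zk: "z + k \<in> H" "z + k \<notin> K" "g (z + k) = g z"
      using that kH subspace_add[OF H(1)] subspace_add_iff[OF Kd(1) k] Kd(3) k by auto
    have "g (s + 0) \<noteq> g (z + k)" using nota[OF that] zk s by auto
    then show ?thesis using line[of 0 "z + k"] zk s subspace_0[OF H(1)] by auto
  qed
  \<comment> \<open>The line through \<open>?t\<close> and \<open>h\<close> contains a point of
    colour \<open>a\<close>, which neither of the two has; so they agree in colour.\<close>
  have tb: "g ?t = ?b" using line[OF kH h(1,2)] t h nota[OF h(1,2)] by auto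
  have step: "g (x + h) = g x" if x: "x \<in> H" "x \<notin> ?L" for x
  proof (rule ccontr)
    assume ne: "g (x + h) \<noteq> g x"
    have xK: "x \<notin> K" using x span_superset by blast
    have hL: "h \<in> ?L" using span_base by blast
    have "x + h \<notin> ?L" using x hL subspace_add_iff[of ?L h x] by auto
    then have xhK: "x + h \<notin> K" using span_superset by blast
    have xh: "x + h \<in> H" using x h subspace_add[OF H(1)] by auto
    have khH: "k + h \<in> H" using kH h subspace_add[OF H(1)] by auto
    have kxH: "k + x \<in> H" using kH x subspace_add[OF H(1)] by auto
    note na = nota[OF x(1) xK] nota[OF xh xhK] nota[OF h(1,2)]
    have c0: "g x \<noteq> ?b \<Longrightarrow> g (x + h) = ?b"
      using rainbow_free_add[OF V(2), of x h] x h xK xhK nz ne H(2) by blast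
    have e1: "g (s + (x + k)) = a \<or> g (s + (x + k)) = g x" by (rule lines[OF x(1) xK])
    have e2: "g (s + (x + h + k)) = a \<or> g (s + (x + h + k)) = g (x + h)" by (rule lines[OF xh xhK])
    have e3: "?b \<noteq> g x \<Longrightarrow> g (s + (x + k)) = ?b \<or> g (s + (x + k)) = g x"
      using line[OF kH x(1) xK] tb by (simp add: add_ac)
    have e4: "g (s + (x + h + k)) = a \<or> g (s + (x + h + k)) = g x"
      using line[OF khH x(1) xK] h(3) na by (simp add: add_ac)
    have e5: "g (s + (x + k)) \<noteq> ?b \<Longrightarrow>
        g (s + (x + h + k)) = g (s + (x + k)) \<or> g (s + (x + h + k)) = ?b"
      using line[OF kxH h(1,2)] by (simp add: add_ac)
    have e6: "?b \<noteq> g (x + h) \<Longrightarrow> g (s + (x + h + k)) = ?b \<or> g (s + (x + h + k)) = g (x + h)"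
      using line[OF kH xh xhK] tb by (simp add: add_ac)
    \<comment> \<open>By \<open>e2\<close> and \<open>e4\<close> the vector
      \<open>s + (x + h + k)\<close> has colour \<open>a\<close>, as \<open>g x\<close> and
      \<open>g (x + h)\<close> differ. By \<open>c0\<close> exactly one of these two is
      \<open>?b\<close>. If it is \<open>g x\<close>, then \<open>e6\<close> excludes
      \<open>a\<close>. If it is \<open>g (x + h)\<close>, then \<open>e1\<close> and
      \<open>e3\<close> give \<open>s + (x + k)\<close> the colour of \<open>x\<close>, and
      \<open>e5\<close> excludes \<open>a\<close>.\<close>
    show False using ne c0 e1 e2 e3 e4 e5 e6 na by metis
  qed
  \<comment> \<open>Dividing \<open>x\<close> by \<open>m\<close> reduces the translation by
    \<open>m *s h\<close> to the one by \<open>h\<close>.\<close>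
  have step': "g (x + m *s h) = g x" if x: "x \<in> H" "x \<notin> ?L" for x m
  proof (cases "m = 0")
    case False
    define y where "y = (1 / m) *s x"
    have y: "y \<in> H" "y \<notin> ?L" "x = m *s y"
      using x False subspace_scale[OF H(1)] subspace_scale_iff[of ?L "1 / m" x]
      unfolding y_def by auto
    have "g (x + m *s h) = g (m *s (y + h))" by (simp add: y(3) scale_right_distrib)
    also have "\<dots> = g (y + h)"
      by (rule rainbow_free_scale[OF V(2)]) (use y h H False subspace_add[OF H(1)] in auto)
    also have "\<dots> = g y" by (rule step) (use y in auto)
    also have "\<dots> = g x"
      using rainbow_free_scale[OF V(2), of y m] y H False by auto
    finally show ?thesis .
  qed simp
  have decomp: "\<exists>m k'. k' \<in> K \<and> y = m *s h + k'" if y: "y \<in> ?L" for y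
  proof -
    obtain m where "y - m *s h \<in> K" using mem_span_insert_subspace[OF Kd(1)] y by blast
    moreover have "y = m *s h + (y - m *s h)" by simp
    ultimately show ?thesis by blast
  qed
  show "colour_module ?L H g"
    unfolding colour_module_def
  proof (intro conjI ballI)
    show "?L \<subseteq> H" by (rule span_minimal) (use h H Kd in auto)
    fix v y assume v: "v \<in> H - ?L" and "y \<in> ?L"
    then obtain m k' where y: "k' \<in> K" "y = m *s h + k'" using decomp by blast
    have mh: "m *s h \<in> ?L" using span_base span_scale by blast
    have "v + m *s h \<notin> ?L" using v mh subspace_add_iff[of ?L "m *s h" v] by auto
    then have "v + m *s h \<notin> K" using span_superset by blast
    moreover have "v + m *s h \<in> H" using v h subspace_add[OF H(1)] subspace_scale[OF H(1)] by auto
    ultimately have "g (v + m *s h + k') = g (v + m *s h)" using Kd(3) y by blast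
    then show "g (v + y) = g v" using step'[of v m] v y by (simp add: add.assoc)
  qed simp
  fix x assume x: "x \<in> ?L" "x \<notin> K"
  then obtain m k' where mk: "k' \<in> K" "x = m *s h + k'" using decomp by blast
  have "m \<noteq> 0" using mk x by auto
  then have "m *s h \<notin> K" using h subspace_scale_iff[OF Kd(1)] by blast
  then have "g x = g (m *s h)" using Kd(3)[of "m *s h" k'] mk h subspace_scale[OF H(1)] by auto
  also have "\<dots> = g h" using rainbow_free_scale[OF V(2), of h m] h H \<open>m \<noteq> 0\<close> by auto
  finally show "g x = ?b" .
qed

text \<open>Outside \<open>H\<close>, colour \<open>a\<close> is first shown to be invariant under
  \<open>K\<close>. The other colours follow by comparing a vector outside \<open>H\<close> with its
  translate into \<open>H\<close> by a vector of colour \<open>a\<close>.\<close>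

lemma colour_module_of_hyperplane_extends:
  assumes V: "subspace V" "rainbow_free V g" and H: "subspace H" "H \<subset> V"
    and hyp: "\<And>x v. \<lbrakk>x \<in> V; v \<in> V; v \<notin> H\<rbrakk> \<Longrightarrow> \<exists>l. x - l *s v \<in> H"
    and K: "colour_module K H g" "K \<noteq> H"
    and max: "\<And>K'. \<lbrakk>colour_module K' H g; K \<subset> K'\<rbrakk> \<Longrightarrow> K' = H"
    and a: "colour_class H g a \<subseteq> K" and spanning: "span (colour_class V g a) = V"
    and nonconst: "\<And>b. \<exists>h\<in>H - K. g h \<noteq> b"
  shows "colour_module K V g"
proof -
  note Kd = colour_moduleD[OF K(1)]
  have KH: "K \<subset> H" using K Kd by blast
  \<comment> \<open>Suppose \<open>s + k\<close> has lost colour \<open>a\<close>. If some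
    \<open>h\<close> in \<open>H - K\<close> restores it, the enlarged module is \<open>H\<close> by
    maximality, so \<open>H - K\<close> has one colour, against \<open>nonconst\<close>. Otherwise
    colour \<open>a\<close> is confined to the span of \<open>s + k\<close> and \<open>K\<close>,
    which is proper.\<close>
  have inv: "g (s + k) = a" if s: "s \<in> V" "s \<notin> H" "g s = a" and k: "k \<in> K" for s k
  proof (rule ccontr)
    assume t: "g (s + k) \<noteq> a"
    have kH: "k \<in> H" using k KH by blast
    have tV: "s + k \<in> V" "s + k \<notin> H"
      using s kH H V subspace_add[OF V(1)] subspace_add_iff[OF H(1) kH] by auto
    have noth: "g (s + k + h) \<noteq> a" if h: "h \<in> H" "h \<notin> K" for h
    proof
      assume h': "g (s + k + h) = a"
      note L = larger_colour_module[OF V H K(1) a s k t h h']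
      have "K \<subseteq> span (insert h K)" "h \<in> span (insert h K)"
        using span_superset[of "insert h K"] by auto
      then have "span (insert h K) = H" using max[OF L(1)] h by blast
      then show False using L(2) nonconst[of "g h"] by auto
    qed
    have "colour_class V g a \<subseteq> span (insert (s + k) K)"
    proof
      fix p assume "p \<in> colour_class V g a"
      then have p: "p \<in> V" "p \<noteq> 0" "g p = a" unfolding colour_class_def by auto
      show "p \<in> span (insert (s + k) K)"
      proof (cases "p \<in> H")
        case True
        then have "p \<in> K" using a p unfolding colour_class_def by auto
        then show ?thesis by (simp add: span_base)
      next
        case False
        obtain l where l: "p - l *s (s + k) \<in> H" using hyp[OF p(1) tV] by blast
        have l0: "l \<noteq> 0" using l False by auto
        \<comment> \<open>Division by \<open>l\<close> makes \<open>s + k + h\<close> a multiple of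
          \<open>p\<close>, so that \<open>noth\<close> applies to it.\<close>
        define h where "h = (1 / l) *s (p - l *s (s + k))"
        have hH: "h \<in> H" unfolding h_def using l subspace_scale[OF H(1)] by blast
        have "s + k + h = (1 / l) *s p"
          unfolding h_def using l0 by (simp add: scale_right_diff_distrib)
        then have "g (s + k + h) = a" using rainbow_free_scale[OF V(2) p(1), of "1 / l"] p l0 by simp
        then have "h \<in> K" using noth hH by blast
        then have "p - l *s (s + k) \<in> K"
          unfolding h_def using subspace_scale_iff[OF Kd(1), of "1 / l"] l0 by auto
        then show ?thesis using mem_span_insert_subspace[OF Kd(1)] by blast
      qed
    qed
    then have "V \<subseteq> span (insert (s + k) K)" using span_minimal spanning by (metis subspace_span)
    moreover have "span (insert (s + k) K) \<subseteq> V" by (rule span_minimal) (use tV KH H V in auto)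
    ultimately show False using span_insert_proper[OF H(1) _ Kd(1) KH tV(2), of V] H(2) by blast
  qed
  obtain s0 where s0: "s0 \<in> V" "s0 \<notin> H" "s0 \<noteq> 0" "g s0 = a"
    using colour_class_outside_hyperplane[OF H spanning] by blast
  have "g (v + k) = g v" if v: "v \<in> V" "v \<notin> K" and k: "k \<in> K" for v k
  proof (cases "v \<in> H")
    case True
    then show ?thesis using Kd(3) v k by blast
  next
    case False
    have kH: "k \<in> H" using k KH by blast
    have vk: "v + k \<in> V" "v + k \<notin> H"
      using v kH H V subspace_add[OF V(1)] subspace_add_iff[OF H(1) kH] False by auto
    show ?thesis
    proof (cases "g v = a \<or> g (v + k) = a")
      case True
      moreover have "g v = a" if "g (v + k) = a"
        using inv[OF vk that, of "- k"] subspace_neg[OF Kd(1) k] by simp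
      ultimately show ?thesis using inv[OF v(1) False _ k] by metis
    next
      case neither: False
      \<comment> \<open>Write \<open>v = s + h\<close> with \<open>s\<close> of colour
        \<open>a\<close> and \<open>h\<close> in \<open>H\<close>. By \<open>inv\<close>,
        \<open>h\<close> is outside \<open>K\<close>. As \<open>v\<close> and \<open>v + k\<close>
        are off colour \<open>a\<close>, they have the colours of \<open>h\<close> and
        \<open>h + k\<close>, which agree because \<open>K\<close> is a colour module of
        \<open>H\<close>.\<close>
      obtain l where l: "v - l *s s0 \<in> H" using hyp[OF v(1) s0(1,2)] by blast
      have l0: "l \<noteq> 0" using l False by auto
      define s h where "s = l *s s0" and "h = v - l *s s0"
      have s: "s \<in> V" "s \<notin> H" "s \<noteq> 0" "g s = a"
        using s0 l0 subspace_scale[OF V(1)] subspace_scale_iff[OF H(1)]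
          rainbow_free_scale[OF V(2)] unfolding s_def by auto
      have v_eq: "v = s + h" by (simp add: s_def h_def)
      have hH: "h \<in> H" using l h_def by simp
      have hK: "h \<notin> K" using inv[OF s(1,2,4), of h] neither v_eq by auto
      have sh: "g (s + y) = g y" if y: "y \<in> H" "y \<notin> K" "g (s + y) \<noteq> a" for y
      proof -
        have y0: "y \<noteq> 0" using y subspace_0[OF Kd(1)] by auto
        then have "g y \<noteq> a" using y a unfolding colour_class_def by auto
        moreover have "s + y \<noteq> 0" using subspace_add_iff[OF H(1) y(1), of s] s subspace_0[OF H(1)] by auto
        ultimately show ?thesis using rainbow_free_add[OF V(2), of s y] s y y0 H(2) by auto
      qed
      have "h + k \<in> H" "h + k \<notin> K" "g (h + k) = g h"
        using hH hK k kH subspace_add[OF H(1)] subspace_add_iff[OF Kd(1) k] Kd(3) by auto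
      then show ?thesis using sh[of h] sh[of "h + k"] neither hH hK v_eq by (simp add: add.assoc)
    qed
  qed
  then show ?thesis unfolding colour_module_def using Kd KH H by auto
qed


section \<open>Planes spanned by three colours\<close>

lemma rainbow_free_combination:
  assumes V: "subspace V" "rainbow_free V g" and uv: "u \<in> V" "v \<in> V" "u \<noteq> 0" "v \<noteq> 0" "g u \<noteq> g v"
    and w: "w \<in> span {u, v}" "w \<noteq> 0"
  shows "g w = g u \<or> g w = g v"
proof -
  obtain l where "w - l *s u \<in> span {v}" using span_breakdown_eq[of w u "{v}"] w by auto
  then obtain m where "w - l *s u = m *s v" unfolding span_singleton by auto
  then have w_eq: "w = l *s u + m *s v" by (simp add: algebra_simps)
  have scale: "x \<in> V \<Longrightarrow> k \<noteq> 0 \<Longrightarrow> g (k *s x) = g x" for k x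
    using rainbow_free_scale[OF V(2)] by blast
  show ?thesis
  proof (cases "l = 0 \<or> m = 0")
    case True
    then show ?thesis using w_eq scale uv w(2) by auto
  next
    case False
    then show ?thesis
      using rainbow_free_add[OF V(2), of "l *s u" "m *s v"] w_eq scale uv w(2)
        subspace_scale[OF V(1)] by auto
  qed
qed

lemma span_pair_eq:
  assumes "w \<in> span {u, v}" "w' \<in> span {u, v}" "w \<noteq> 0" "w' \<notin> span {w}"
  shows "span {w, w'} = span {u, v}"
proof -
  have ind: "independent {w, w'}"
    using assms by (simp add: insert_commute[of w] independent_insert)
  have "w \<noteq> w'" using assms span_base[of w "{w}"] by blast
  then have card: "card {w, w'} = 2" by simp
  have mem: "x \<in> span {w, w'}" if x: "x \<in> {u, v}" for x
  proof (rule ccontr)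
    assume nx: "x \<notin> span {w, w'}"
    then have "x \<notin> {w, w'}" using span_base by blast
    then have "card (insert x {w, w'}) = 3" using card by simp
    moreover have "independent (insert x {w, w'})" using ind nx by (rule independent_insertI[rotated])
    then have "card (insert x {w, w'}) \<le> card {u, v}"
      using independent_span_bound[of "{u, v}" "insert x {w, w'}"] assms x span_base by blast
    moreover have "card {u, v} \<le> 2" by (simp add: card_insert_if)
    ultimately show False by linarith
  qed
  show ?thesis
  proof (rule subset_antisym)
    show "span {w, w'} \<subseteq> span {u, v}" by (rule span_minimal) (use assms in auto)
    show "span {u, v} \<subseteq> span {w, w'}" by (rule span_minimal) (use mem in auto)
  qed
qed

text \<open>Two vectors of different colours are independent, so they span the line, and every
  nonzero combination of them takes one of their colours.\<close>

lemma not_three_colours_on_line: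
  assumes V: "subspace V" "rainbow_free V g" and uv: "u \<in> V" "v \<in> V"
    and w: "w1 \<in> span {u, v}" "w2 \<in> span {u, v}" "w3 \<in> span {u, v}" "w1 \<noteq> 0" "w2 \<noteq> 0" "w3 \<noteq> 0"
    and ne: "g w1 \<noteq> g w2" "g w3 \<noteq> g w1" "g w3 \<noteq> g w2"
  shows False
proof -
  have sub: "span {u, v} \<subseteq> V" by (rule span_minimal) (use uv V in auto)
  have "w2 \<notin> span {w1}"
  proof
    assume "w2 \<in> span {w1}"
    then obtain l where l: "w2 = l *s w1" unfolding span_singleton by auto
    then have "l \<noteq> 0" using w(5) by auto
    then show False using rainbow_free_scale[OF V(2), of w1 l] l w sub ne by auto
  qed
  then have "span {w1, w2} = span {u, v}" using span_pair_eq w by blast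
  then have "w3 \<in> span {w1, w2}" using w(3) by simp
  then show False
    using rainbow_free_combination[OF V, of w1 w2 w3] w sub ne by blast
qed

lemma span_singleton_eqD:
  assumes "span {v} = span {w}" "v \<noteq> 0"
  obtains l where "l \<noteq> 0" "v = l *s w"
proof -
  have "v \<in> span {w}" using assms span_base[of v "{v}"] by auto
  then obtain l where "v = l *s w" unfolding span_singleton by auto
  then show ?thesis using that assms(2) by (cases "l = 0") auto
qed

lemma span_singleton_eqI:
  assumes "v \<in> span {w}" "v \<noteq> 0"
  shows "span {v} = span {w}"
proof -
  obtain l where l: "v = l *s w" using assms(1) unfolding span_singleton by auto
  then have "l \<noteq> 0" using assms(2) by auto
  then show ?thesis using span_image_scale[of "{w}" "\<lambda>_. l"] l by simp
qed

text \<open>Otherwise \<open>u\<close>, \<open>v\<close>, \<open>u'\<close>, \<open>v'\<close> would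
  be four independent vectors in the span of three.\<close>

lemma span_pairs_meet:
  assumes sub: "{u, v, u', v'} \<subseteq> span {a, b, c}"
    and ind: "u \<noteq> 0" "v \<notin> span {u}" "u' \<noteq> 0" "v' \<notin> span {u'}"
  shows "\<exists>w. w \<in> span {u, v} \<and> w \<in> span {u', v'} \<and> w \<noteq> 0"
proof (rule ccontr)
  assume "\<not> ?thesis"
  then have disj: "w = 0" if "w \<in> span {u, v}" "w \<in> span {u', v'}" for w using that by blast
  have 2: "independent {v, u}" using ind by (simp add: independent_insert)
  have u': "u' \<notin> span {v, u}"
    using disj[of u'] span_base[of u' "{u', v'}"] ind by (auto simp: insert_commute)
  then have 3: "independent {u', v, u}" using 2 by (rule independent_insertI)
  have v': "v' \<notin> span {u', v, u}"
  proof
    assume "v' \<in> span {u', v, u}"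
    then obtain l where l: "v' - l *s u' \<in> span {v, u}" using span_breakdown_eq by blast
    moreover have "v' - l *s u' \<in> span {u', v'}" by (intro span_diff span_scale span_base) auto
    ultimately have "v' - l *s u' = 0" using disj by (metis insert_commute)
    then have "v' = l *s u'" by simp
    then show False using ind(4) unfolding span_singleton by auto
  qed
  have 4: "independent {v', u', v, u}" using v' 3 by (rule independent_insertI)
  have "v \<noteq> u" using ind(2) span_superset[of "{u}"] by auto
  moreover have "u' \<notin> {v, u}" using u' span_superset[of "{v, u}"] by auto
  moreover have "v' \<notin> {u', v, u}" using v' span_superset[of "{u', v, u}"] by auto
  ultimately have "card {v', u', v, u} = 4" by simp
  moreover have "card {v', u', v, u} \<le> card {a, b, c}"
    using independent_span_bound[OF _ 4, of "{a, b, c}"] sub by auto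
  moreover have "card {a, b, c} \<le> 3" by (simp add: card_insert_if)
  ultimately show False by linarith
qed

lemma not_plane_with_spanning_classes:
  assumes fin: "finite V" and V: "subspace V" "rainbow_free V g"
    and abc: "a \<in> V" "b \<in> V" "c \<in> V" "a \<noteq> 0" "b \<noteq> 0" "c \<noteq> 0"
    and distinct: "g a \<noteq> g b" "g c \<noteq> g a" "g c \<noteq> g b"
    and span_abc: "V = span {a, b, c}"
    and spanning: "\<And>x. \<lbrakk>x \<in> V; x \<noteq> 0\<rbrakk> \<Longrightarrow> span (colour_class V g (g x)) = V"
  shows False
proof -
  define pt where "pt v = span {v}" for v
  define pts where "pts I = pt ` {v \<in> V. v \<noteq> 0 \<and> g v \<in> I}" for I
  define line where "line u v = pt ` (span {u, v} - {0})" for u v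
  define lines where "lines = {line u v | u v. u \<in> V \<and> v \<in> V \<and> u \<noteq> 0 \<and> v \<notin> span {u}}"
  \<comment> \<open>All colours other than those of \<open>a\<close> and \<open>b\<close> are merged
    into the third class; a line meeting all three classes still shows three colours.\<close>
  let ?X = "pts {g a}" and ?Y = "pts {g b}" and ?Z = "pts (- {g a, g b})"
  have pt_eqD: "\<exists>l. l \<noteq> 0 \<and> v = l *s w" if "pt v = pt w" "v \<noteq> 0" for v w
    using span_singleton_eqD[of v w] that unfolding pt_def by metis
  have in_pts: "pt v \<in> pts I \<longleftrightarrow> g v \<in> I" if v: "v \<in> V" "v \<noteq> 0" for v I
  proof
    assume "pt v \<in> pts I"
    then obtain w where w: "w \<in> V" "w \<noteq> 0" "g w \<in> I" "pt v = pt w" unfolding pts_def by blast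
    then show "g v \<in> I" using pt_eqD[OF w(4) v(2)] rainbow_free_scale[OF V(2)] by auto
  qed (use v in \<open>auto simp: pts_def\<close>)
  have in_line: "pt w \<in> line u v \<longleftrightarrow> w \<in> span {u, v}" if w: "w \<noteq> 0" for w u v
  proof
    assume "pt w \<in> line u v"
    then obtain w' where w': "w' \<in> span {u, v}" "pt w = pt w'" unfolding line_def by blast
    then show "w \<in> span {u, v}" using pt_eqD[OF w'(2) w] span_scale by blast
  qed (use w in \<open>auto simp: line_def\<close>)
  have all: "?X \<union> ?Y \<union> ?Z = pt ` (V - {0})" unfolding pts_def by blast
  have cover: "\<exists>v. v \<in> V \<and> v \<noteq> 0 \<and> p = pt v" if "p \<in> ?X \<union> ?Y \<union> ?Z" for p
    using that unfolding all by blast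
  have sub: "span {u, v} \<subseteq> V" if "u \<in> V" "v \<in> V" for u v
    by (rule span_minimal) (use that V in auto)
  have linesE: "\<exists>u v. u \<in> V \<and> v \<in> V \<and> u \<noteq> 0 \<and> v \<notin> span {u} \<and> L = line u v" if "L \<in> lines" for L
    using that unfolding lines_def by blast
  \<comment> \<open>A line containing a whole colour class would contain its span \<open>V\<close>,
    and with it the three colours of \<open>a\<close>, \<open>b\<close> and
    \<open>c\<close>.\<close>
  have pts_span: "\<not> pts I \<subseteq> L" if L: "L \<in> lines" and x: "x \<in> V" "x \<noteq> 0" "g x \<in> I" for L I x
  proof
    assume "pts I \<subseteq> L"
    obtain u v where uv: "u \<in> V" "v \<in> V" "L = line u v" using linesE[OF L] by blast
    have "w \<in> span {u, v}" if w: "w \<in> colour_class V g (g x)" for w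
    proof -
      have w': "w \<in> V" "w \<noteq> 0" "g w \<in> I" using w x unfolding colour_class_def by auto
      then have "pt w \<in> line u v" using in_pts \<open>pts I \<subseteq> L\<close> uv by blast
      then show ?thesis using in_line w' by blast
    qed
    then have "span (colour_class V g (g x)) \<subseteq> span {u, v}" by (intro span_minimal) auto
    then have "V \<subseteq> span {u, v}" using spanning x by simp
    then show False
      using not_three_colours_on_line[OF V uv(1,2), of a b c] abc distinct by blast
  qed
  have "coloured_plane ?X ?Y ?Z lines"
  proof (rule coloured_plane.intro)
    show "finite (?X \<union> ?Y \<union> ?Z)" unfolding all using fin by simp
    have dj: "pts I \<inter> pts J = {}" if "I \<inter> J = {}" for I J
    proof (rule ccontr)
      assume "pts I \<inter> pts J \<noteq> {}"
      then obtain v where v: "v \<in> V" "v \<noteq> 0" "g v \<in> I" "pt v \<in> pts J"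
        unfolding pts_def[of I] by blast
      then show False using in_pts[OF v(1,2)] that by blast
    qed
    show "?X \<inter> ?Y = {}" "?X \<inter> ?Z = {}" "?Y \<inter> ?Z = {}" by (rule dj; use distinct in auto)+
    show "?X \<noteq> {}" "?Y \<noteq> {}" "?Z \<noteq> {}" using abc distinct unfolding pts_def by auto
    show "\<not> ?X \<subseteq> L" "\<not> ?Y \<subseteq> L" "\<not> ?Z \<subseteq> L" if "L \<in> lines" for L
      using pts_span[OF that, of a] pts_span[OF that, of b] pts_span[OF that, of c] abc distinct
      by auto
    show "L \<subseteq> ?X \<union> ?Y \<union> ?Z" if L: "L \<in> lines" for L
    proof -
      obtain u v where uv: "u \<in> V" "v \<in> V" "L = line u v" using linesE[OF L] by blast
      then show ?thesis unfolding all line_def using sub by blast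
    qed
    show "\<exists>L\<in>lines. x \<in> L \<and> y \<in> L"
      if xy: "x \<in> ?X \<union> ?Y \<union> ?Z" "y \<in> ?X \<union> ?Y \<union> ?Z" "x \<noteq> y" for x y
    proof -
      obtain u v where u: "u \<in> V" "u \<noteq> 0" "x = pt u" and v: "v \<in> V" "v \<noteq> 0" "y = pt v"
        using cover[OF xy(1)] cover[OF xy(2)] by blast
      have "v \<notin> span {u}" using span_singleton_eqI[of v u] u v xy(3) unfolding pt_def by auto
      then have "line u v \<in> lines" unfolding lines_def using u v by blast
      moreover have "x \<in> line u v" "y \<in> line u v" using in_line u v span_base by auto
      ultimately show ?thesis by blast
    qed
    show "L = M" if LM: "L \<in> lines" "M \<in> lines" and xy: "x \<in> L" "y \<in> L" "x \<in> M" "y \<in> M" "x \<noteq> y"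
      for L M x y
    proof -
      obtain u v where uv: "L = line u v" using linesE[OF LM(1)] by blast
      obtain u' v' where uv': "M = line u' v'" using linesE[OF LM(2)] by blast
      obtain w where w: "w \<noteq> 0" "x = pt w" using xy(1) unfolding uv line_def by blast
      obtain w' where w': "w' \<noteq> 0" "y = pt w'" using xy(2) unfolding uv line_def by blast
      have "w' \<notin> span {w}" using span_singleton_eqI[of w' w] w w' xy(5) unfolding pt_def by auto
      then have "span {w, w'} = span {u, v}" "span {w, w'} = span {u', v'}"
        using span_pair_eq w w' in_line xy uv uv' by blast+
      then show ?thesis unfolding uv uv' line_def by simp
    qed
    show "L \<inter> M \<noteq> {}" if LM: "L \<in> lines" "M \<in> lines" for L M
    proof -
      obtain u v where uv: "u \<in> V" "v \<in> V" "u \<noteq> 0" "v \<notin> span {u}" "L = line u v"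
        using linesE[OF LM(1)] by blast
      obtain u' v' where uv': "u' \<in> V" "v' \<in> V" "u' \<noteq> 0" "v' \<notin> span {u'}" "M = line u' v'"
        using linesE[OF LM(2)] by blast
      have "{u, v, u', v'} \<subseteq> span {a, b, c}" using uv uv' span_abc by blast
      then obtain w where "w \<in> span {u, v}" "w \<in> span {u', v'}" "w \<noteq> 0"
        using span_pairs_meet[of u v u' v' a b c] uv uv' by blast
      then have "pt w \<in> L \<inter> M" using in_line uv uv' by blast
      then show ?thesis by blast
    qed
    show "L \<inter> ?X = {} \<or> L \<inter> ?Y = {} \<or> L \<inter> ?Z = {}" if L: "L \<in> lines" for L
    proof (rule ccontr)
      assume neg: "\<not> ?thesis"
      obtain u v where uv: "u \<in> V" "v \<in> V" "L = line u v" using linesE[OF L] by blast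
      have ex: "\<exists>w. w \<in> span {u, v} \<and> w \<noteq> 0 \<and> g w \<in> I" if ne: "L \<inter> pts I \<noteq> {}" for I
      proof -
        obtain w where w: "w \<in> V" "w \<noteq> 0" "g w \<in> I" "pt w \<in> L" using ne unfolding pts_def by blast
        then show ?thesis using in_line uv by blast
      qed
      obtain w1 where w1: "w1 \<in> span {u, v}" "w1 \<noteq> 0" "g w1 = g a" using ex[of "{g a}"] neg by blast
      obtain w2 where w2: "w2 \<in> span {u, v}" "w2 \<noteq> 0" "g w2 = g b" using ex[of "{g b}"] neg by blast
      obtain w3 where w3: "w3 \<in> span {u, v}" "w3 \<noteq> 0" "g w3 \<notin> {g a, g b}"
        using ex[of "- {g a, g b}"] neg by blast
      show False
        using not_three_colours_on_line[OF V uv(1,2) w1(1) w2(1) w3(1)] w1 w2 w3 distinct by auto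
    qed
  qed
  then show False using not_coloured_plane by blast
qed

section \<open>Hyperplanes and the induction\<close>

lemma ex_hyperplane_containing:
  assumes fin: "finite V" and V: "subspace V" and W: "subspace W" "W \<subset> V"
  obtains H where "subspace H" "H \<subset> V" "W \<subseteq> H"
    "\<And>x v. \<lbrakk>x \<in> V; v \<in> V; v \<notin> H\<rbrakk> \<Longrightarrow> \<exists>l. x - l *s v \<in> H"
proof -
  have "\<exists>H. (subspace H \<and> H \<subset> V) \<and> W \<subseteq> H \<and> (\<forall>D. subspace D \<and> D \<subset> V \<longrightarrow> H \<subseteq> D \<longrightarrow> D = H)"
    by (rule ex_maximal_subset[OF fin]) (use W in auto)
  then obtain H where H: "subspace H" "H \<subset> V" "W \<subseteq> H"
    and max: "\<forall>D. subspace D \<and> D \<subset> V \<longrightarrow> H \<subseteq> D \<longrightarrow> D = H" by blast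
  \<comment> \<open>Adjoining \<open>v\<close> to the maximal proper subspace \<open>H\<close> gives
    all of \<open>V\<close>; this states codimension one without dimensions.\<close>
  have "\<exists>l. x - l *s v \<in> H" if xv: "x \<in> V" "v \<in> V" "v \<notin> H" for x v
  proof -
    have "span (insert v H) \<subseteq> V" by (rule span_minimal) (use xv H V in auto)
    moreover have "insert v H \<subseteq> span (insert v H)" by (rule span_superset)
    ultimately have "span (insert v H) = V" using max xv(3) by blast
    then show ?thesis using mem_span_insert_subspace[OF H(1), of x v] xv by blast
  qed
  then show ?thesis using that H by blast
qed

lemma ex_three_if_card_gt_2:
  assumes "card (g ` S) > 2"
  obtains x y z where "x \<in> S" "y \<in> S" "z \<in> S" "g x \<noteq> g y" "g z \<noteq> g x" "g z \<noteq> g y"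
proof -
  obtain T where "T \<subseteq> g ` S" "card T = 3"
    using assms obtain_subset_with_card_n[of 3 "g ` S"] by auto
  then obtain p q r where "{p, q, r} \<subseteq> g ` S" "p \<noteq> q" "q \<noteq> r" "p \<noteq> r"
    unfolding card_3_iff by blast
  then show ?thesis using that by auto
qed

theorem ex_two_coloured_complement:
  assumes "finite V" "subspace V" "rainbow_free V g" "V \<noteq> {0}"
  shows "\<exists>U. subspace U \<and> U \<subset> V \<and> card (g ` (V - U)) \<le> 2"
  using assms
proof (induction "card V" arbitrary: V rule: less_induct)
  case less
  note fin = less.prems(1) and V = less.prems(2,3)
  have IH: "\<exists>U. subspace U \<and> U \<subset> C \<and> card (g ` (C - U)) \<le> 2"
    if C: "subspace C" "C \<subset> V" "C \<noteq> {0}" for C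
  proof (rule less.hyps)
    show "card C < card V" using C fin by (simp add: psubset_card_mono)
    show "finite C" using C fin finite_subset by blast
    show "rainbow_free C g" using rainbow_free_subset[OF V(2)] C by blast
  qed (use C in auto)
  show ?case
  proof (rule ccontr)
    assume neg: "\<not> ?case"
    have trivial_module: "K = {0} \<or> K = V" if "colour_module K V g" for K
      using two_coloured_complement_of_colour_module[OF fin V(1) that _ _ IH] neg by blast
    have spanning: "span (colour_class V g (g x)) = V" if x: "x \<in> V" "x \<noteq> 0" for x
    proof -
      have "x \<in> span (colour_class V g (g x))"
        by (rule span_base) (use x in \<open>simp add: colour_class_def\<close>)
      then show ?thesis using trivial_module[OF colour_module_span_colour_class[OF V]] x by blast
    qed
    have "{0} \<subset> V" using less.prems(4) subspace_0[OF V(1)] by blast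
    \<comment> \<open>Otherwise \<open>{0}\<close> itself would serve as \<open>U\<close>.\<close>
    then have "card (g ` (V - {0})) > 2" using neg subspace_single_0 by (meson not_le)
    then obtain x y z where xyz: "x \<in> V - {0}" "y \<in> V - {0}" "z \<in> V - {0}"
      and ne: "g x \<noteq> g y" "g z \<noteq> g x" "g z \<noteq> g y" by (rule ex_three_if_card_gt_2)
    have "span {x, y, z} \<noteq> V"
      using not_plane_with_spanning_classes[OF fin V, of x y z] xyz ne spanning by auto
    moreover have "span {x, y, z} \<subseteq> V" by (rule span_minimal) (use xyz V in auto)
    ultimately obtain H where H: "subspace H" "H \<subset> V" "span {x, y, z} \<subseteq> H"
      and hyp: "\<And>x v. \<lbrakk>x \<in> V; v \<in> V; v \<notin> H\<rbrakk> \<Longrightarrow> \<exists>l. x - l *s v \<in> H"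
      using ex_hyperplane_containing[OF fin V(1), of "span {x, y, z}"] by blast
    have xyzH: "x \<in> H" "y \<in> H" "z \<in> H" using H(3) span_superset[of "{x, y, z}"] by auto
    have rfH: "rainbow_free H g" using rainbow_free_subset[OF V(2)] H(2) by blast
    obtain U where U: "subspace U" "U \<subset> H" "card (g ` (H - U)) \<le> 2"
      using IH[OF H(1,2)] xyzH xyz by blast
    \<comment> \<open>At most two colours occur on \<open>H - U\<close>, so one of the three is
      absent there, and its class in \<open>H\<close> lies inside \<open>U\<close>.\<close>
    have "\<exists>w\<in>{x, y, z}. g w \<notin> g ` (H - U)"
    proof (rule ccontr)
      assume "\<not> ?thesis"
      then have "card {g x, g y, g z} \<le> card (g ` (H - U))"
        by (intro card_mono) (use finite_subset[OF _ fin] H in auto)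
      moreover have "card {g x, g y, g z} = 3" using ne by auto
      ultimately show False using U(3) by linarith
    qed
    then obtain w where w: "w \<in> H" "w \<noteq> 0" "w \<in> V" "g w \<notin> g ` (H - U)" using xyz xyzH by blast
    define a where "a = g w"
    let ?K0 = "span (colour_class H g a)"
    have "colour_class H g a \<subseteq> U"
    proof
      fix v assume "v \<in> colour_class H g a"
      then have "v \<in> H" "g w = g v" unfolding colour_class_def a_def by auto
      then show "v \<in> U" using w(4) by auto
    qed
    then have "?K0 \<subseteq> U" using U(1) by (rule span_minimal)
    moreover have "colour_module ?K0 H g" by (rule colour_module_span_colour_class[OF H(1) rfH])
    ultimately have "colour_module ?K0 H g \<and> ?K0 \<subset> H" using U(2) by blast
    \<comment> \<open>\<open>?K0\<close> lies in \<open>U\<close> and so is proper in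
      \<open>H\<close>. Maximality among proper modules is what
      \<open>colour_module_of_hyperplane_extends\<close> asks for.\<close>
    then have "\<exists>K. (colour_module K H g \<and> K \<subset> H) \<and> ?K0 \<subseteq> K \<and>
        (\<forall>D. colour_module D H g \<and> D \<subset> H \<longrightarrow> K \<subseteq> D \<longrightarrow> D = K)"
      by (intro ex_maximal_subset[OF fin]) (use H in auto)
    then obtain K where K: "colour_module K H g" "K \<subset> H" "?K0 \<subseteq> K"
      and max: "\<forall>D. colour_module D H g \<and> D \<subset> H \<longrightarrow> K \<subseteq> D \<longrightarrow> D = K" by blast
    note Kd = colour_moduleD[OF K(1)]
    have aK: "colour_class H g a \<subseteq> K" using K(3) span_superset[of "colour_class H g a"] by blast
    have wK: "w \<in> K" using aK w unfolding colour_class_def a_def by auto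
    have span_a: "span (colour_class V g a) = V" unfolding a_def using spanning w by blast
    show False
    proof (cases "\<exists>b. \<forall>h\<in>H - K. g h = b")
      case True
      then obtain b where b: "\<forall>h\<in>H - K. g h = b" by blast
      obtain h where h: "h \<in> H" "h \<notin> K" using K by blast
      then have "h \<notin> colour_class H g a" "h \<noteq> 0" using aK subspace_0[OF Kd(1)] by auto
      then have ab: "a \<noteq> b" using b h unfolding colour_class_def by auto
      \<comment> \<open>Three distinct colours cannot all be among \<open>a\<close> and
        \<open>b\<close>.\<close>
      obtain t where t: "t \<in> {x, y, z}" "g t \<noteq> a" "g t \<noteq> b" using ne by (metis insert_iff)
      then have "span (colour_class V g (g t)) = V" using spanning xyz by blast
      then show False
        using not_constant_off_colour_module[OF V H(1,2) hyp Kd(1) K(2), of b a "g t"] b span_a t ab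
        by blast
    next
      case False
      have "colour_module K V g"
      proof (rule colour_module_of_hyperplane_extends[OF V H(1,2) hyp K(1)])
        show "K' = H" if "colour_module K' H g" "K \<subset> K'" for K'
          using max that colour_moduleD(2)[OF that(1)] by blast
        show "\<exists>h\<in>H - K. g h \<noteq> b" for b using False by blast
      qed (use K(2) aK span_a in auto)
      \<comment> \<open>\<open>K\<close> contains the nonzero \<open>w\<close> and is proper, so it
        is a nontrivial colour module of \<open>V\<close>.\<close>
      then show False using trivial_module[of K] wK w K(2) H(2) by blast
    qed
  qed
qed


theorem ex_two_coloured_flag:
  assumes "finite V" "subspace V" "rainbow_free V g"
  shows "\<exists>(k::nat) W. (\<forall>i\<le>k. subspace (W i) \<and> W i \<subseteq> V) \<and> W 0 = {0} \<and> W k = V \<and>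
    (\<forall>i<k. W i \<subseteq> W (i + 1)) \<and> (\<forall>i<k. card (g ` (W (i + 1) - W i)) \<le> 2)"
  using assms
proof (induction "card V" arbitrary: V rule: less_induct)
  case less
  show ?case
  proof (cases "V = {0}")
    case True
    then show ?thesis using less.prems by (intro exI[of _ 0] exI[of _ "\<lambda>_. V"]) auto
  next
    case False
    then obtain U where U: "subspace U" "U \<subset> V" "card (g ` (V - U)) \<le> 2"
      using ex_two_coloured_complement[OF less.prems] by blast
    have "card U < card V" using U less.prems by (simp add: psubset_card_mono)
    moreover have "finite U" "rainbow_free U g"
      using U less.prems finite_subset rainbow_free_subset[of V g U] by auto
    ultimately obtain k :: nat and W where W: "\<forall>i\<le>k. subspace (W i) \<and> W i \<subseteq> U" "W 0 = {0}" "W k = U"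
      "\<forall>i<k. W i \<subseteq> W (i + 1)" "\<forall>i<k. card (g ` (W (i + 1) - W i)) \<le> 2"
      using less.hyps[of U] U(1) by blast
    \<comment> \<open>The flag of \<open>U\<close> is continued by \<open>V\<close> at index
      \<open>k + 1\<close>.\<close>
    define W' where "W' i = (if i \<le> k then W i else V)" for i
    have "subspace (W i) \<and> W i \<subseteq> V" if "i \<le> k" for i using W(1) U(2) that by blast
    then have "\<forall>i\<le>k + 1. subspace (W' i) \<and> W' i \<subseteq> V" using less.prems(2) unfolding W'_def by auto
    moreover have "W' 0 = {0}" "W' (k + 1) = V" using W(2) unfolding W'_def by auto
    moreover have "W' i \<subseteq> W' (i + 1)" "card (g ` (W' (i + 1) - W' i)) \<le> 2" if "i < k + 1" for i
      using W U that unfolding W'_def by (cases "i = k"; simp)+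
    ultimately show ?thesis by blast
  qed
qed

end

section \<open>From vectors back to the projective geometry\<close>

interpretation fun_cvs: coloured_vector_space fun_scale
  by (rule coloured_vector_space.intro) (rule fun_vs.vector_space_axioms)

lemma finite_coord_space: "finite (coord_space n :: (nat \<Rightarrow> 'a::{field,finite}) set)"
proof -
  have "coord_space n = {v :: nat \<Rightarrow> 'a. \<forall>i. (i \<in> {..<n} \<longrightarrow> v i \<in> UNIV) \<and> (i \<notin> {..<n} \<longrightarrow> v i = 0)}"
    unfolding coord_space_def by auto
  then show ?thesis using finite_set_of_finite_funs[of "{..<n}" "UNIV :: 'a set" 0] by simp
qed

lemma subspace_coord_space: "fun_vs.subspace (coord_space n)"
  unfolding fun_vs.subspace_def coord_space_def by (auto simp: fun_scale_def)

lemma span_singleton_in_pg_points: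
  assumes "v \<in> coord_space n" "v \<noteq> 0"
  shows "fun_vs.span {v} \<in> pg_points n"
proof -
  have "fun_vs.span {v} \<subseteq> coord_space n"
    by (rule fun_vs.span_minimal) (use assms subspace_coord_space in auto)
  moreover have "fun_vs.independent {v}" using assms by simp
  then have "fun_vs.dim (fun_vs.span {v}) = 1" using fun_vs.dim_eq_card_independent by fastforce
  ultimately show ?thesis unfolding pg_points_def by simp
qed

lemma pg_pointsE:
  assumes "p \<in> pg_points n"
  obtains v where "v \<in> coord_space n" "v \<noteq> 0" "p = fun_vs.span {v}"
proof -
  have p: "fun_vs.subspace p" "p \<subseteq> coord_space n" "fun_vs.dim p = 1"
    using assms unfolding pg_points_def by auto
  obtain B where B: "B \<subseteq> p" "fun_vs.independent B" "p \<subseteq> fun_vs.span B" "card B = fun_vs.dim p"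
    by (rule fun_vs.basis_exists)
  then obtain v where v: "B = {v}" using p(3) by (auto simp: card_1_singleton_iff)
  have "v \<noteq> 0" using B(2) v by auto
  moreover have "p = fun_vs.span {v}" using fun_vs.span_subspace B(1,3) v p(1) by blast
  moreover have "v \<in> coord_space n" using B(1) v p(2) by auto
  ultimately show ?thesis using that by blast
qed

theorem theorem1p7:
  fixes n q :: nat
    and G :: "'p geometry"
    and c :: "'p \<Rightarrow> 'c"
  assumes "primepow q"
    and "card (UNIV :: 'a::{field,finite} set) = q"
    and "geom_iso G (proj_geometry n :: (nat \<Rightarrow> 'a) set geometry)"
    and "\<And>L. L \<in> dim_subspaces G 2 \<Longrightarrow> card (c ` L) \<le> 2"
  shows "\<exists>(k::nat) (W :: nat \<Rightarrow> 'p set).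
    (\<forall>i\<le>k. geom_subspace G (W i)) \<and>
    W 0 = {} \<and> W k = points G \<and>
    (\<forall>i<k. W i \<subseteq> W (i + 1)) \<and>
    (\<forall>i<k. card (c ` (W (i + 1) - W i)) \<le> 2)"
proof -
  let ?V = "coord_space n :: (nat \<Rightarrow> 'a) set"
  obtain f where f: "bij_betw f (points G) (pg_points n :: (nat \<Rightarrow> 'a) set set)"
    and iso: "\<And>d X. X \<in> dim_subspaces G d \<longleftrightarrow>
      X \<subseteq> points G \<and> f ` X \<in> dim_subspaces (proj_geometry n :: (nat \<Rightarrow> 'a) set geometry) d"
    using assms(3) unfolding geom_iso_def proj_geometry_def by auto
  have f_img: "f ` points G = pg_points n" using f by (simp add: bij_betw_def)
  define S where "S U = {p \<in> points G. f p \<subseteq> U}" for U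
  \<comment> \<open>The colouring is carried along the isomorphism. The span of 0 is not a point, so
    \<open>g 0\<close> is arbitrary.\<close>
  define g where "g v = c (inv_into (points G) f (fun_vs.span {v}))" for v
  have g_pt: "g v = c p" if "p \<in> points G" "f p = fun_vs.span {v}" for p v
    unfolding g_def that(2)[symmetric] using bij_betw_inv_into_left[OF f that(1)] by simp
  have ex_pt: "\<exists>p\<in>points G. f p = fun_vs.span {v}" if "v \<in> ?V" "v \<noteq> 0" for v
    using span_singleton_in_pg_points[OF that] f_img by (metis imageE)
  \<comment> \<open>Since \<open>card\<close> of an infinite set is 0, a bound on the number of
    colours passes to subsets only for finite colour sets.\<close>
  have "finite (pg_points n :: (nat \<Rightarrow> 'a) set set)"
    by (rule finite_subset[of _ "Pow ?V"]) (auto simp: pg_points_def finite_coord_space)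
  then have fin_points: "finite (points G)" using f bij_betw_finite by blast
  have S_sub: "S U \<in> dim_subspaces G (fun_vs.dim U)" if U: "fun_vs.subspace U" "U \<subseteq> ?V" for U
  proof -
    have "f ` S U = {p \<in> pg_points n. p \<subseteq> U}" unfolding S_def f_img[symmetric] by auto
    then show ?thesis unfolding iso using U by (auto simp: S_def proj_geometry_def)
  qed
  have "fun_cvs.rainbow_free ?V g"
    unfolding fun_cvs.rainbow_free_def
  proof (intro conjI ballI allI impI)
    fix v :: "nat \<Rightarrow> 'a" and l :: 'a assume "l \<noteq> 0"
    then show "g (fun_scale l v) = g v"
      using fun_vs.span_image_scale[of "{v}" "\<lambda>_. l"] by (simp add: g_def)
  next
    fix u v :: "nat \<Rightarrow> 'a" assume uv: "u \<in> ?V" "v \<in> ?V" "u \<noteq> 0" "v \<noteq> 0" "u + v \<noteq> 0"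
    show "g u = g v \<or> g (u + v) = g u \<or> g (u + v) = g v"
    proof (rule ccontr)
      assume neg: "\<not> ?thesis"
      let ?L = "fun_vs.span {u, v}"
      have LV: "?L \<subseteq> ?V" by (rule fun_vs.span_minimal) (use uv subspace_coord_space in auto)
      \<comment> \<open>Proportional vectors span the same point and would have the same colour.
        Hence \<open>u\<close> and \<open>v\<close> span a line of the geometry, and it would show
        three colours.\<close>
      have "v \<notin> fun_vs.span {u}"
        using fun_cvs.span_singleton_eqI[of v u] uv neg unfolding g_def by auto
      then have "fun_vs.independent {v, u}" "v \<noteq> u"
        using uv neg by (auto simp: fun_vs.independent_insert)
      then have "fun_vs.dim ?L = 2"
        using fun_vs.dim_eq_card_independent[of "{v, u}"] by (simp add: insert_commute)
      then have "card (c ` S ?L) \<le> 2" using S_sub[of ?L] LV assms(4)[of "S ?L"] by simp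
      moreover have "g w \<in> c ` S ?L" if w: "w \<in> ?L" "w \<noteq> 0" for w
      proof -
        obtain p where p: "p \<in> points G" "f p = fun_vs.span {w}" using ex_pt w LV by blast
        have "fun_vs.span {w} \<subseteq> ?L" by (rule fun_vs.span_minimal) (use w in auto)
        then show ?thesis using g_pt[OF p] p unfolding S_def by auto
      qed
      then have "{g u, g v, g (u + v)} \<subseteq> c ` S ?L"
        using uv fun_vs.span_base[of _ "{u, v}"] fun_vs.span_add[of u "{u, v}" v] by auto
      then have "card {g u, g v, g (u + v)} \<le> card (c ` S ?L)"
        by (rule card_mono[rotated]) (use fin_points in \<open>simp add: S_def\<close>)
      moreover have "card {g u, g v, g (u + v)} = 3" using neg by auto
      ultimately show False by linarith
    qed
  qed
  note flag = fun_cvs.ex_two_coloured_flag[OF finite_coord_space subspace_coord_space this]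
  obtain k :: nat and W where W: "\<forall>i\<le>k. fun_vs.subspace (W i) \<and> W i \<subseteq> ?V" "W 0 = {0}" "W k = ?V"
    "\<forall>i<k. W i \<subseteq> W (i + 1)" "\<forall>i<k. card (g ` (W (i + 1) - W i)) \<le> 2"
    using flag by (elim exE conjE) (rule that)
  have "geom_subspace G (S (W i))" if "i \<le> k" for i
    using S_sub W(1) that unfolding geom_subspace_def by blast
  moreover have "S (W 0) = {}"
  proof -
    have "\<not> f p \<subseteq> {0}" if p: "p \<in> points G" for p
    proof -
      have "f p \<in> pg_points n" using f_img p by blast
      then obtain v where "v \<in> ?V" "v \<noteq> 0" "f p = fun_vs.span {v}" by (rule pg_pointsE)
      then show ?thesis using fun_vs.span_base[of v "{v}"] by auto
    qed
    then show ?thesis unfolding S_def W(2) by blast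
  qed
  moreover have "S (W k) = points G"
    using f_img unfolding S_def W(3) pg_points_def by blast
  moreover have "S (W i) \<subseteq> S (W (i + 1))" if "i < k" for i
    using W(4) that unfolding S_def by blast
  moreover have "card (c ` (S (W (i + 1)) - S (W i))) \<le> 2" if i: "i < k" for i
  proof -
    have sub: "fun_vs.subspace (W i)" "W (i + 1) \<subseteq> ?V" using W(1) i by auto
    \<comment> \<open>A point added between two members of the flag is spanned by a vector of
      \<open>W (i + 1)\<close> outside \<open>W i\<close>, whose colour is that of the
      point.\<close>
    have "c ` (S (W (i + 1)) - S (W i)) \<subseteq> g ` (W (i + 1) - W i)"
    proof (rule image_subsetI)
      fix p assume p: "p \<in> S (W (i + 1)) - S (W i)"
      then have pG: "p \<in> points G" unfolding S_def by blast
      have "f p \<in> pg_points n" using f_img pG by blast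
      then obtain v where v: "v \<in> ?V" "v \<noteq> 0" "f p = fun_vs.span {v}" by (rule pg_pointsE)
      have "v \<in> W (i + 1)" using p v(3) fun_vs.span_base[of v "{v}"] unfolding S_def by auto
      moreover have "v \<notin> W i"
      proof
        assume "v \<in> W i"
        then have "f p \<subseteq> W i" unfolding v(3) by (intro fun_vs.span_minimal sub) auto
        then show False using p pG unfolding S_def by blast
      qed
      ultimately show "c p \<in> g ` (W (i + 1) - W i)" using g_pt[OF pG v(3), symmetric] by blast
    qed
    then have "card (c ` (S (W (i + 1)) - S (W i))) \<le> card (g ` (W (i + 1) - W i))"
      by (rule card_mono[rotated]) (use sub finite_coord_space finite_subset in blast)
    then show ?thesis using W(5) i by fastforce
  qed
  ultimately show ?thesis by (intro exI[of _ k] exI[of _ "\<lambda>i. S (W i)"]) simp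
qed

end
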